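(* Let $a<b$ be real numbers, let $\Omega=(a,b)\subset\mathbb{R}$, and let $\lambda>0$. Then there exists $f\in C^\infty(\mathbb{R})$ satisfying $\int_0^s f(t)\,dt\leq 0$ for every $s\in\mathbb{R}$, such that the problem $$-u''=\lambda u+f(u)\ \text{ in }(a,b),\qquad u(a)=u(b)=0,$$ admits a nontrivial solution $u\in C^\infty[a,b]$.
   Context: A solution is nontrivial if it is not identically zero. Functions are real-valued. In general a solution means a bounded weak solution, i.e. $u\in H_0^1(a,b)\cap L^\infty(a,b)$ with $\int_a^b u'\varphi'=\lambda\int_a^b u\varphi+\int_a^b f(u)\varphi$ for all $\varphi\in H_0^1(a,b)$; for $u\in C^\infty[a,b]$ this is the same as satisfying the equation and the boundary conditions pointwise. *)

theory Defs
  imports "HOL-Analysis.Analysis"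
begin

text \<open>
  \<open>smooth_real_on S f\<close> says that \<open>f\<close> is of class $C^\infty$ on \<open>S\<close>: \<open>D n\<close> is the
  \<open>n\<close>-th derivative of \<open>f\<close> on \<open>S\<close>.  Derivatives are taken within \<open>S\<close>, hence they are
  one-sided at the end points when \<open>S = {a..b}\<close> with \<open>a < b\<close>, which gives the space
  $C^\infty[a,b]$ and makes the values of \<open>f\<close> outside \<open>S\<close> irrelevant; for \<open>S = UNIV\<close>
  one obtains $C^\infty(\mathbb{R})$.
\<close>

definition smooth_real_on :: "real set \<Rightarrow> (real \<Rightarrow> real) \<Rightarrow> bool" where
  "smooth_real_on S f \<longleftrightarrow>
     (\<exists>D :: nat \<Rightarrow> real \<Rightarrow> real.
        (\<forall>x\<in>S. D 0 x = f x) \<and>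
        (\<forall>n. \<forall>x\<in>S. (D n has_real_derivative D (Suc n) x) (at x within S)))"

text \<open>
  \<open>u\<close> solves $-u'' = \lambda u + f(u)$ in $(a,b)$ with $u(a) = u(b) = 0$, pointwise.
  For \<open>u\<close> in $C^\infty[a,b]$ the iterated \<open>deriv\<close> is the genuine second derivative at
  every point of the open interval.
\<close>

definition dirichlet_solution ::
    "real \<Rightarrow> real \<Rightarrow> real \<Rightarrow> (real \<Rightarrow> real) \<Rightarrow> (real \<Rightarrow> real) \<Rightarrow> bool" where
  "dirichlet_solution a b lam f u \<longleftrightarrow>
     (\<forall>x\<in>{a<..<b}. - deriv (deriv u) x = lam * u x + f (u x)) \<and> u a = 0 \<and> u b = 0"

end

theory Submission
  imports Defs
begin

text \<open>
  With \<open>\<omega> = \<pi> / (b - a)\<close> and \<open>Q t = t - (1 - 1/k) tanh t\<close>, the function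
  \<open>u x = Q (arsinh (k sin (\<omega> (x - a))))\<close> solves an autonomous equation \<open>u'' = \<omega>\<^sup>2 q(tanh (Q\<^sup>-\<^sup>1 u))\<close>
  with a polynomial \<open>q\<close>, and \<open>f v = - \<omega>\<^sup>2 q(tanh (Q\<^sup>-\<^sup>1 v)) - \<lambda> v\<close> is smooth on the whole line because \<open>Q\<close> is a
  diffeomorphism.  Conservation of energy expresses the primitive of \<open>f\<close> at \<open>Q t\<close> as
  \<open>\<omega>\<^sup>2 (1 - Q'(t)\<^sup>2 (k\<^sup>2 - (k\<^sup>2 + 1) tanh\<^sup>2 t)) / 2 - \<lambda> Q(t)\<^sup>2 / 2\<close>.
  The first term is at most \<open>\<omega>\<^sup>2\<close>, and it is nonpositive unless \<open>cosh\<^sup>2 t > k/2\<close>; in the latter case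
  \<open>\<bar>Q t\<bar>\<close> is at least of order \<open>ln k\<close>, so a large \<open>k\<close> makes the primitive nonpositive however small \<open>\<lambda>\<close> is.
\<close>

section \<open>Smoothness from algebras closed under differentiation\<close>

inductive_set fun_algebra :: "(real \<Rightarrow> real) set \<Rightarrow> (real \<Rightarrow> real) set" for B where
  gen: "g \<in> B \<Longrightarrow> g \<in> fun_algebra B"
| const: "(\<lambda>x. c) \<in> fun_algebra B"
| add: "g \<in> fun_algebra B \<Longrightarrow> h \<in> fun_algebra B \<Longrightarrow> (\<lambda>x. g x + h x) \<in> fun_algebra B"
| mult: "g \<in> fun_algebra B \<Longrightarrow> h \<in> fun_algebra B \<Longrightarrow> (\<lambda>x. g x * h x) \<in> fun_algebra B"

lemma fun_algebra_uminus: "g \<in> fun_algebra B \<Longrightarrow> (\<lambda>x. - g x) \<in> fun_algebra B"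
  using fun_algebra.mult[OF fun_algebra.const[of "-1"]] by simp

lemma fun_algebra_diff:
  "g \<in> fun_algebra B \<Longrightarrow> h \<in> fun_algebra B \<Longrightarrow> (\<lambda>x. g x - h x) \<in> fun_algebra B"
  using fun_algebra.add[OF _ fun_algebra_uminus] by simp

lemma fun_algebra_power: "g \<in> fun_algebra B \<Longrightarrow> (\<lambda>x. g x ^ n) \<in> fun_algebra B"
  by (induction n) (auto intro: fun_algebra.intros)

lemmas fun_algebra_intros =
  fun_algebra.add fun_algebra.mult fun_algebra_uminus fun_algebra_diff fun_algebra_power fun_algebra.const

text \<open>Choosing a derivative inside \<open>A\<close> for each member gives an operator on
  \<open>A\<close>; its iterates at \<open>f\<close> are the required sequence
  \<open>D\<close>.\<close>

lemma smooth_real_on_derivative_closed: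
  assumes "f \<in> A"
    and "\<And>g. g \<in> A \<Longrightarrow> \<exists>g'\<in>A. \<forall>x\<in>S. (g has_real_derivative g' x) (at x within S)"
  shows "smooth_real_on S f"
proof -
  obtain d where d: "\<And>g. g \<in> A \<Longrightarrow> d g \<in> A"
      "\<And>g x. g \<in> A \<Longrightarrow> x \<in> S \<Longrightarrow> (g has_real_derivative d g x) (at x within S)"
    using assms(2) by metis
  have "(d ^^ n) f \<in> A" for n
    by (induction n) (use assms(1) d(1) in auto)
  then show ?thesis
    unfolding smooth_real_on_def
    by (intro exI[of _ "\<lambda>n. (d ^^ n) f"]) (auto intro: d(2))
qed

text \<open>The sum and product rules reduce the claim to the generators. Smoothness of an explicit
  function then only needs a finite set of generators whose derivatives are polynomials in
  them.\<close>

lemma smooth_real_on_fun_algebra: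
  assumes f: "f \<in> fun_algebra B"
    and B: "\<And>g. g \<in> B \<Longrightarrow> \<exists>g'\<in>fun_algebra B. \<forall>x. (g has_real_derivative g' x) (at x)"
  shows "smooth_real_on S f"
proof (rule smooth_real_on_derivative_closed[OF f])
  fix g assume "g \<in> fun_algebra B"
  then have "\<exists>g'\<in>fun_algebra B. \<forall>x. (g has_real_derivative g' x) (at x)"
  proof induction
    case (const c)
    show ?case by (auto intro!: bexI[of _ "\<lambda>x. 0"] fun_algebra.const)
  next
    case (add g h)
    then obtain g' h' where "g' \<in> fun_algebra B" "h' \<in> fun_algebra B"
      "\<And>x. (g has_real_derivative g' x) (at x)" "\<And>x. (h has_real_derivative h' x) (at x)" by blast
    then show ?case
      by (intro bexI[of _ "\<lambda>x. g' x + h' x"]) (auto intro!: fun_algebra.add derivative_intros)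
  next
    case (mult g h)
    then obtain g' h' where gh: "g' \<in> fun_algebra B" "h' \<in> fun_algebra B"
      "\<And>x. (g has_real_derivative g' x) (at x)" "\<And>x. (h has_real_derivative h' x) (at x)" by blast
    have "((\<lambda>x. g x * h x) has_real_derivative g' x * h x + h' x * g x) (at x)" for x
      using DERIV_mult[OF gh(3,4)] .
    then show ?case
      by (intro bexI[of _ "\<lambda>x. g' x * h x + h' x * g x"])
        (auto intro!: fun_algebra.add fun_algebra.mult gh mult.hyps)
  qed (rule B)
  then show "\<exists>g'\<in>fun_algebra B. \<forall>x\<in>S. (g has_real_derivative g' x) (at x within S)"
    by (blast intro: has_field_derivative_at_within)
qed

section \<open>The explicit functions behind the solution\<close>

text \<open>The coefficient makes the slope \<open>1/k\<close> at 0, cancelling the slope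
  \<open>k\<close> of \<open>wave k\<close> there, while far out the slope tends to 1.\<close>

definition profile :: "real \<Rightarrow> real \<Rightarrow> real" where
  "profile k t = t - (1 - 1/k) * tanh t"

definition profile_inv :: "real \<Rightarrow> real \<Rightarrow> real" where
  "profile_inv k = the_inv (profile k)"

text \<open>The derivative of \<open>profile k\<close> at \<open>t\<close>, as a function of \<open>\<tau> = tanh t\<close>.\<close>
definition slope :: "real \<Rightarrow> real \<Rightarrow> real" where
  "slope k \<tau> = 1/k + (1 - 1/k) * \<tau>\<^sup>2"

text \<open>For \<open>Q = profile k\<close>, \<open>w = wave k y\<close> and
  \<open>\<tau> = tanh w\<close>, this is \<open>Q''(w) w'^2 + Q'(w) w''\<close> with
  \<open>y\<close> eliminated.\<close>

definition accel :: "real \<Rightarrow> real \<Rightarrow> real" where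
  "accel k \<tau> = 2 * (1 - 1/k) * \<tau> * (1 - \<tau>\<^sup>2) * (k\<^sup>2 - (k\<^sup>2 + 1) * \<tau>\<^sup>2)
     - slope k \<tau> * (k\<^sup>2 + 1) * \<tau> * (1 - \<tau>\<^sup>2)"

text \<open>Twice the negative of a primitive of \<open>\<lambda>v. accel k (tanh (profile_inv k v))\<close>, normalised to vanish at \<open>v = 0\<close>.\<close>
definition potential :: "real \<Rightarrow> real \<Rightarrow> real" where
  "potential k \<tau> = 1 - (slope k \<tau>)\<^sup>2 * (k\<^sup>2 - (k\<^sup>2 + 1) * \<tau>\<^sup>2)"

definition wave :: "real \<Rightarrow> real \<Rightarrow> real" where
  "wave k y = arsinh (k * sin y)"

context
  fixes k :: real
  assumes k: "k \<ge> 2"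
begin

section \<open>The profile as a diffeomorphism of the line, and smoothness of the
  nonlinearity\<close>

lemma slope_pos: "slope k \<tau> > 0"
  using k by (auto simp: slope_def intro!: add_pos_nonneg)

lemma has_real_derivative_tanh: "(tanh has_real_derivative 1 - (tanh t)\<^sup>2) (at t)" for t :: real
  by (auto intro!: derivative_eq_intros)

lemma sech_square: "(inverse (cosh t))\<^sup>2 = 1 - (tanh t)\<^sup>2" for t :: real
proof -
  have "(inverse (cosh t))\<^sup>2 = ((cosh t)\<^sup>2 - (sinh t)\<^sup>2) / (cosh t)\<^sup>2"
    using cosh_square_eq[of t] by (simp add: power_inverse divide_inverse)
  also have "\<dots> = 1 - (tanh t)\<^sup>2"
    by (simp add: tanh_def diff_divide_distrib power_divide)
  finally show ?thesis .
qed

lemma profile_deriv: "(profile k has_real_derivative slope k (tanh t)) (at t)"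
  unfolding profile_def[abs_def] slope_def
  by (rule has_real_derivative_tanh derivative_eq_intros refl)+ (simp add: algebra_simps)

lemma continuous_on_profile: "continuous_on S (profile k)"
  by (metis profile_deriv DERIV_isCont continuous_at_imp_continuous_on)

lemma profile_strict_mono: "strict_mono (profile k)"
proof (rule strict_monoI)
  fix x y :: real assume "x < y"
  then show "profile k x < profile k y"
    using DERIV_pos_imp_increasing[of x y "profile k"] profile_deriv slope_pos by blast
qed

text \<open>The \<open>tanh\<close> term has modulus at most 1. This yields surjectivity here and
  the growth estimate for the primitive later.\<close>

lemma abs_profile_ge: "\<bar>profile k t\<bar> \<ge> \<bar>t\<bar> - 1"
proof -
  have "\<bar>(1 - 1/k) * tanh t\<bar> \<le> 1 * 1"
    unfolding abs_mult using k tanh_real_bounds[of t] by (intro mult_mono) auto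
  then show ?thesis unfolding profile_def by linarith
qed

lemma profile_zero: "profile k 0 = 0"
  by (simp add: profile_def)

lemma surj_profile: "surj (profile k)"
proof -
  have "\<exists>t. profile k t = v" for v
  proof -
    \<comment> \<open>With this \<open>c\<close> the lower bound gives modulus at least
      \<open>\<bar>v\<bar>\<close> at both end points; monotonicity fixes the signs.\<close>
    define c where "c = \<bar>v\<bar> + 1"
    have "profile k c \<ge> profile k 0" "profile k (-c) \<le> profile k 0"
      using profile_strict_mono by (auto simp: strict_mono_less_eq c_def)
    then have "profile k (-c) \<le> v" "v \<le> profile k c"
      using abs_profile_ge[of c] abs_profile_ge[of "-c"] by (auto simp: c_def profile_zero)
    then show ?thesis
      using IVT'[of "profile k" "-c" v c] continuous_on_profile by (auto simp: c_def)
  qed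
  then show ?thesis by (metis surjI)
qed

lemma profile_inv: "profile k (profile_inv k v) = v" "profile_inv k (profile k t) = t"
proof -
  have "inj (profile k)" using profile_strict_mono strict_mono_imp_inj_on by blast
  then show "profile k (profile_inv k v) = v" "profile_inv k (profile k t) = t"
    using surj_profile by (auto simp: profile_inv_def f_the_inv_into_f the_inv_f_f)
qed

lemma profile_inv_deriv:
  "(profile_inv k has_real_derivative inverse (slope k (tanh (profile_inv k v)))) (at v)"
proof (rule DERIV_inverse_function)
  show "(profile k has_real_derivative slope k (tanh (profile_inv k v))) (at (profile_inv k v))"
    by (rule profile_deriv)
  show "slope k (tanh (profile_inv k v)) \<noteq> 0" using slope_pos by (metis less_irrefl)
  have "isCont (profile_inv k) (profile k (profile_inv k v))"
    by (rule isCont_inverse_function2[of "profile_inv k v - 1" _ "profile_inv k v + 1"])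
      (auto simp: profile_inv intro: DERIV_isCont profile_deriv)
  then show "isCont (profile_inv k) v" by (simp add: profile_inv)
  show "v - 1 < v" "v < v + 1" by auto
qed (rule profile_inv)

lemma tanh_profile_inv_deriv:
  "((\<lambda>v. tanh (profile_inv k v)) has_real_derivative
     (1 - (tanh (profile_inv k v))\<^sup>2) * inverse (slope k (tanh (profile_inv k v)))) (at v)"
  by (rule DERIV_chain2[OF has_real_derivative_tanh profile_inv_deriv])

text \<open>Inverting the profile brings in the reciprocal slope \<open>r\<close>. Taking
  \<open>r\<close> as a generator next to \<open>\<tau>\<close> and the identity closes the algebra,
  since \<open>r'\<close> is a polynomial in \<open>\<tau>\<close> and \<open>r\<close>.\<close>

lemma smooth_nonlinearity: 
  "smooth_real_on S (\<lambda>v. - c * accel k (tanh (profile_inv k v)) - lam * v)"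
proof -
  define \<tau> where "\<tau> = (\<lambda>v. tanh (profile_inv k v))"
  define r where "r = (\<lambda>v. inverse (slope k (\<tau> v)))"
  define B where "B = {\<lambda>v. v, \<tau>, r}"
  have gen: "\<tau> \<in> fun_algebra B" "r \<in> fun_algebra B" "(\<lambda>v. v) \<in> fun_algebra B"
    by (auto simp: B_def intro: fun_algebra.gen)
  have d\<tau>: "(\<tau> has_real_derivative (1 - (\<tau> v)\<^sup>2) * r v) (at v)" for v
    using tanh_profile_inv_deriv by (simp add: \<tau>_def r_def)
  have "((\<lambda>v. slope k (\<tau> v)) has_real_derivative 2 * (1 - 1/k) * \<tau> v * ((1 - (\<tau> v)\<^sup>2) * r v)) (at v)" for v
    unfolding slope_def by (rule derivative_eq_intros d\<tau> refl)+ simp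
  from DERIV_inverse_fun[OF this less_imp_neq[OF slope_pos, symmetric]]
  have dr: "(r has_real_derivative - 2 * (1 - 1/k) * \<tau> v * (1 - (\<tau> v)\<^sup>2) * r v ^ 3) (at v)" for v
    unfolding r_def by (rule DERIV_cong)
      (simp only: numeral_3_eq_3 power_Suc power_0 mult_1_right mult_1_left
        inverse_mult_distrib mult_minus_left mult_minus_right mult_ac)
  have alg: "(\<lambda>v. 1) \<in> fun_algebra B" "(\<lambda>v. (1 - (\<tau> v)\<^sup>2) * r v) \<in> fun_algebra B"
      "(\<lambda>v. - 2 * (1 - 1/k) * \<tau> v * (1 - (\<tau> v)\<^sup>2) * r v ^ 3) \<in> fun_algebra B"
    by (intro fun_algebra_intros gen)+
  have f: "(\<lambda>v. - c * accel k (\<tau> v) - lam * v) \<in> fun_algebra B"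
    unfolding accel_def slope_def by (intro fun_algebra_intros gen)
  have "smooth_real_on S (\<lambda>v. - c * accel k (\<tau> v) - lam * v)"
  proof (rule smooth_real_on_fun_algebra[OF f])
    fix g assume "g \<in> B"
    then consider "g = (\<lambda>v. v)" | "g = \<tau>" | "g = r" by (auto simp: B_def)
    then show "\<exists>g'\<in>fun_algebra B. \<forall>x. (g has_real_derivative g' x) (at x)"
      by cases (erule ssubst, rule bexI, rule allI, rule DERIV_ident d\<tau> dr, rule alg)+
  qed
  then show ?thesis by (simp add: \<tau>_def)
qed

section \<open>Energy identity and sign of the primitive\<close>

text \<open>Conservation of energy: the reciprocal slope from the inverse profile cancels one slope
  factor of the derivative of \<open>potential k\<close>.\<close>

lemma potential_deriv:
  "((\<lambda>v. potential k (tanh (profile_inv k v))) has_real_derivative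
     - 2 * accel k (tanh (profile_inv k v))) (at v)"
proof -
  define \<tau> where "\<tau> = tanh (profile_inv k v)"
  have s: "slope k \<tau> \<noteq> 0" using slope_pos by (metis less_irrefl)
  have "(potential k has_real_derivative
      - (2 * slope k \<tau> * (2 * (1 - 1/k) * \<tau>) * (k\<^sup>2 - (k\<^sup>2 + 1) * \<tau>\<^sup>2)
         - (slope k \<tau>)\<^sup>2 * (2 * (k\<^sup>2 + 1) * \<tau>))) (at \<tau>)"
    unfolding potential_def[abs_def] slope_def
    by (rule derivative_eq_intros refl)+ (simp add: algebra_simps)
  from DERIV_chain2[OF this[unfolded \<tau>_def] tanh_profile_inv_deriv, folded \<tau>_def]
  show ?thesis unfolding \<tau>_def[symmetric]
  proof (rule DERIV_cong)
    define p where "p = slope k \<tau>"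
    show "- (2 * slope k \<tau> * (2 * (1 - 1 / k) * \<tau>) * (k\<^sup>2 - (k\<^sup>2 + 1) * \<tau>\<^sup>2) -
       (slope k \<tau>)\<^sup>2 * (2 * (k\<^sup>2 + 1) * \<tau>)) * ((1 - \<tau>\<^sup>2) * inverse (slope k \<tau>)) =
       - 2 * accel k \<tau>"
      using s unfolding accel_def p_def[symmetric]
      by (simp add: field_simps power2_eq_square)
  qed
qed

text \<open>The slope is at most 1 and the bracket at least -1. This crude bound serves for large
  arguments.\<close>

lemma potential_le_2: 
  assumes "\<tau>\<^sup>2 \<le> 1"
  shows "potential k \<tau> \<le> 2"
proof -
  have "slope k \<tau> \<le> 1/k + (1 - 1/k) * 1"
    unfolding slope_def using k assms by (intro add_left_mono mult_left_mono) auto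
  then have s: "(slope k \<tau>)\<^sup>2 \<le> 1" using slope_pos[of \<tau>] by (simp add: power_le_one)
  have "k\<^sup>2 * \<tau>\<^sup>2 \<le> k\<^sup>2 * 1" using assms by (intro mult_left_mono) auto
  then have "- 1 \<le> k\<^sup>2 - (k\<^sup>2 + 1) * \<tau>\<^sup>2" using assms by (simp add: algebra_simps)
  then have "(slope k \<tau>)\<^sup>2 * (- 1) \<le> (slope k \<tau>)\<^sup>2 * (k\<^sup>2 - (k\<^sup>2 + 1) * \<tau>\<^sup>2)"
    by (intro mult_left_mono) auto
  then show ?thesis unfolding potential_def using s by linarith
qed

lemma potential_nonpos:
  assumes "k * (1 - \<tau>\<^sup>2) \<ge> 2"
  shows "potential k \<tau> \<le> 0"
proof -
  define y where "y = \<tau>\<^sup>2"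
  define z where "z = k\<^sup>2 - (k\<^sup>2 + 1) * y"
  have y: "0 \<le> y" "y \<le> 1" "k * (1 - y) \<ge> 2"
  proof -
    show "k * (1 - y) \<ge> 2" using assms by (simp add: y_def)
    then have "0 < k * (1 - y)" by linarith
    then show "y \<le> 1" using k by (simp add: zero_less_mult_iff)
  qed (simp add: y_def)
  \<comment> \<open>Here \<open>z = k^2 (1 - y) - y\<close>, with \<open>y\<close> at most
    1.\<close>
  have "k * (k * (1 - y)) \<ge> k * 2" using y k by (intro mult_left_mono) auto
  then have z: "z \<ge> 2 * k - 1" using y by (simp add: z_def algebra_simps power2_eq_square)
  have ks: "k * slope k \<tau> = 1 + (k - 1) * y"
    unfolding slope_def y_def using k by (simp add: field_simps)
  \<comment> \<open>Discarding the quadratic term leaves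
    \<open>(1 + 2 (k - 1) y) z \<ge> k^2\<close> to show; as \<open>z = k^2 - (k^2 + 1) y\<close>,
    it suffices that \<open>2 (k - 1) z \<ge> k^2 + 1\<close>.\<close>
  have "(1 + (k - 1) * y)\<^sup>2 \<ge> 1 + 2 * (k - 1) * y"
    using zero_le_power2[of "(k - 1) * y"] by (simp add: power2_eq_square algebra_simps)
  then have "(1 + 2 * (k - 1) * y) * z \<le> (1 + (k - 1) * y)\<^sup>2 * z"
    using z k by (intro mult_right_mono) auto
  also have "\<dots> = k\<^sup>2 * ((slope k \<tau>)\<^sup>2 * z)" by (simp add: ks[symmetric] power_mult_distrib)
  finally have 1: "(1 + 2 * (k - 1) * y) * z \<le> k\<^sup>2 * ((slope k \<tau>)\<^sup>2 * z)" .
  have "2 * (k - 1) * z \<ge> 2 * (k - 1) * (2 * k - 1)" using z k by (intro mult_left_mono) auto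
  moreover have "2 * (k - 1) * (2 * k - 1) \<ge> k\<^sup>2 + 1"
  proof -
    \<comment> \<open>The difference of the two sides is \<open>3 k (k - 2) + 1\<close>; this is
      where \<open>k \<ge> 2\<close> enters.\<close>
    have "3 * k * (k - 2) \<ge> 0" using k by simp
    then show ?thesis by (simp add: power2_eq_square algebra_simps)
  qed
  ultimately have "y * (2 * (k - 1) * z) \<ge> y * (k\<^sup>2 + 1)" using y by (intro mult_left_mono) auto
  then have "(1 + 2 * (k - 1) * y) * z \<ge> k\<^sup>2" by (simp add: z_def algebra_simps)
  with 1 have "k\<^sup>2 * 1 \<le> k\<^sup>2 * ((slope k \<tau>)\<^sup>2 * z)" by simp
  then have "1 \<le> (slope k \<tau>)\<^sup>2 * z" using k by (subst (asm) mult_le_cancel_left_pos) auto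
  then show ?thesis by (simp add: potential_def z_def y_def)
qed

text \<open>Where the potential may be positive,
  \<open>k/2 < cosh^2 t \<le> exp (2 \<bar>t\<bar>)\<close>. The threshold for \<open>k\<close> then
  forces \<open>\<bar>t\<bar> \<ge> 1 + sqrt (2/\<mu>)\<close>; the profile loses at most 1, so the
  right-hand side is at least 2.\<close>

lemma potential_le_profile:
  assumes \<mu>: "\<mu> > 0" and large: "k \<ge> 2 * exp (2 * (1 + sqrt (2 / \<mu>)))"
  shows "potential k (tanh t) \<le> \<mu> * (profile k t)\<^sup>2"
proof (cases "k * (1 - (tanh t)\<^sup>2) \<ge> 2")
  case True
  then show ?thesis using potential_nonpos[OF True] \<mu>
    by (smt (verit) mult_nonneg_nonneg zero_le_power2)
next
  case False
  have "(cosh t)\<^sup>2 * (1 - (tanh t)\<^sup>2) = 1"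
    unfolding sech_square[symmetric] by (simp add: power_inverse)
  then have "k = (cosh t)\<^sup>2 * (k * (1 - (tanh t)\<^sup>2))"
    by (simp only: mult.left_commute[of "(cosh t)\<^sup>2" k] mult_1_right)
  also have "\<dots> < (cosh t)\<^sup>2 * 2" using False by (intro mult_strict_left_mono) auto
  finally have "exp (2 * (1 + sqrt (2 / \<mu>))) \<le> (cosh t)\<^sup>2" using large by simp
  also have "cosh t \<le> exp \<bar>t\<bar>"
    by (cases "t \<ge> 0") (auto simp: cosh_def)
  then have "(cosh t)\<^sup>2 \<le> (exp \<bar>t\<bar>)\<^sup>2" by (intro power_mono) auto
  also have "\<dots> = exp (2 * \<bar>t\<bar>)" by (simp add: exp_double)
  finally have "sqrt (2 / \<mu>) \<le> \<bar>t\<bar> - 1" by simp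
  then have "sqrt (2 / \<mu>) \<le> \<bar>profile k t\<bar>" using abs_profile_ge[of t] by linarith
  then have "(sqrt (2 / \<mu>))\<^sup>2 \<le> \<bar>profile k t\<bar>\<^sup>2" using \<mu> by (intro power_mono) auto
  then have "2 \<le> \<mu> * (profile k t)\<^sup>2" using \<mu> by (simp add: field_simps)
  moreover have "(tanh t)\<^sup>2 \<le> 1" using tanh_real_bounds[of t] by (auto simp: abs_square_le_1)
  ultimately show ?thesis using potential_le_2 by fastforce
qed

lemma integral_nonlinearity_nonpos:
  fixes s :: real
  assumes "c > 0" "lam > 0" and large: "k \<ge> 2 * exp (2 * (1 + sqrt (2 / (lam / c))))"
  shows "(LBINT v=0..s. - c * accel k (tanh (profile_inv k v)) - lam * v) \<le> 0"
proof -
  \<comment> \<open>The explicit primitive supplied by the energy identity; the fundamental theorem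
    covers both signs of \<open>s\<close>.\<close>
  define F where "F = (\<lambda>v. c / 2 * potential k (tanh (profile_inv k v)) - lam / 2 * v\<^sup>2)"
  have "(F has_real_derivative - c * accel k (tanh (profile_inv k v)) - lam * v) (at v)" for v
    unfolding F_def
    by (rule derivative_eq_intros potential_deriv refl)+ (simp add: algebra_simps)
  then have dF: "(F has_vector_derivative - c * accel k (tanh (profile_inv k v)) - lam * v) (at v within S)" for v S
    by (meson has_real_derivative_iff_has_vector_derivative has_vector_derivative_at_within)
  have "isCont (\<lambda>v. accel k (tanh (profile_inv k v))) v" for v
  proof (rule isCont_o2[OF DERIV_isCont[OF tanh_profile_inv_deriv]])
    show "isCont (accel k) \<tau>" for \<tau>
      unfolding accel_def[abs_def] slope_def by (intro continuous_intros) (use k in simp_all)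
  qed
  then have "continuous_on S (\<lambda>v. - c * accel k (tanh (profile_inv k v)) - lam * v)" for S
    by (intro continuous_at_imp_continuous_on continuous_intros ballI)
  then have "(LBINT v=ereal 0..ereal s. - c * accel k (tanh (profile_inv k v)) - lam * v) = F s - F 0"
    using dF by (intro interval_integral_FTC_finite)
  \<comment> \<open>The slope \<open>1/k\<close> at 0 makes the potential
    \<open>1 - (1/k)^2 k^2 = 0\<close>.\<close>
  moreover have "F 0 = 0"
    using profile_inv(2)[of 0] k
    by (simp add: F_def profile_zero potential_def slope_def power_divide)
  moreover have "F s \<le> 0"
  proof -
    have "c / 2 * potential k (tanh (profile_inv k s)) \<le> c / 2 * ((lam / c) * s\<^sup>2)"
      using potential_le_profile[OF _ large, of "profile_inv k s"] assms
      by (intro mult_left_mono) (auto simp: profile_inv)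
    then show ?thesis using assms by (simp add: F_def)
  qed
  ultimately show ?thesis by (simp add: zero_ereal_def)
qed

section \<open>The wave, its autonomous equation and its smoothness\<close>

lemma wave_deriv: "(wave k has_real_derivative k * cos y * inverse (cosh (wave k y))) (at y)"
  unfolding wave_def[abs_def]
  by (rule DERIV_cong[OF DERIV_chain2[OF arsinh_real_has_field_derivative DERIV_cmult[OF DERIV_sin]]])
    (simp add: cosh_arsinh_real divide_inverse)

lemma wave_sin: "k * sin y * inverse (cosh (wave k y)) = tanh (wave k y)"
  by (simp add: tanh_def wave_def field_simps)

text \<open>The left side is the squared derivative of \<open>wave k\<close>. Since
  \<open>sinh (wave k y) = k sin y\<close>, writing \<open>cos^2\<close> as \<open>1 - sin^2\<close>
  removes \<open>y\<close>, which makes the final equation autonomous.\<close>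

lemma wave_cos:
  "(k * cos y * inverse (cosh (wave k y)))\<^sup>2 = k\<^sup>2 - (k\<^sup>2 + 1) * (tanh (wave k y))\<^sup>2"
proof -
  have "(k * cos y * inverse (cosh (wave k y)))\<^sup>2
      = k\<^sup>2 * (inverse (cosh (wave k y)))\<^sup>2 - (k * sin y * inverse (cosh (wave k y)))\<^sup>2"
    by (simp only: power_mult_distrib cos_squared_eq) (simp add: algebra_simps)
  then show ?thesis
    unfolding wave_sin sech_square by (simp add: algebra_simps)
qed

lemma tanh_wave_deriv:
  "((\<lambda>y. tanh (wave k y)) has_real_derivative
    (1 - (tanh (wave k y))\<^sup>2) * (k * cos y * inverse (cosh (wave k y)))) (at y)"
  by (rule DERIV_chain2[OF has_real_derivative_tanh wave_deriv])

lemma sech_wave_deriv: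
  "((\<lambda>y. inverse (cosh (wave k y))) has_real_derivative
    - tanh (wave k y) * inverse (cosh (wave k y)) * (k * cos y * inverse (cosh (wave k y)))) (at y)"
  by (rule derivative_eq_intros wave_deriv refl)+
    (auto simp: tanh_def divide_inverse)

lemma profile_wave_deriv:
  "((\<lambda>y. profile k (wave k y)) has_real_derivative
    slope k (tanh (wave k y)) * (k * cos y * inverse (cosh (wave k y)))) (at y)"
  by (rule DERIV_chain2[OF profile_deriv wave_deriv])

lemma profile_wave_deriv2:
  "((\<lambda>y. slope k (tanh (wave k y)) * (k * cos y * inverse (cosh (wave k y)))) has_real_derivative
    accel k (tanh (wave k y))) (at y)"
proof -
  define \<tau> \<rho> where "\<tau> = tanh (wave k y)" and "\<rho> = inverse (cosh (wave k y))"
  define w where "w = k * cos y * \<rho>"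
  have w2: "w\<^sup>2 = k\<^sup>2 - (k\<^sup>2 + 1) * \<tau>\<^sup>2" using wave_cos by (simp add: w_def \<tau>_def \<rho>_def)
  have s: "k * sin y * \<rho> = \<tau>" using wave_sin by (simp add: \<tau>_def \<rho>_def)
  have "((\<lambda>y. slope k (tanh (wave k y))) has_real_derivative 2 * (1 - 1/k) * \<tau> * ((1 - \<tau>\<^sup>2) * w)) (at y)"
    unfolding slope_def
    by (rule derivative_eq_intros tanh_wave_deriv refl)+ (simp add: \<tau>_def w_def \<rho>_def)
  moreover have "((\<lambda>y. k * cos y * inverse (cosh (wave k y))) has_real_derivative
      - (k * sin y * \<rho>) + k * cos y * (- \<tau> * \<rho> * w)) (at y)"
    by (rule derivative_eq_intros sech_wave_deriv refl)+ (simp add: \<tau>_def w_def \<rho>_def)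
  ultimately have "((\<lambda>y. slope k (tanh (wave k y)) * (k * cos y * inverse (cosh (wave k y)))) has_real_derivative
     2 * (1 - 1/k) * \<tau> * ((1 - \<tau>\<^sup>2) * w) * w
      + (- (k * sin y * \<rho>) + k * cos y * (- \<tau> * \<rho> * w)) * slope k \<tau>) (at y)"
    unfolding \<tau>_def w_def \<rho>_def by (rule DERIV_mult)
  \<comment> \<open>This is the second derivative of \<open>wave k\<close>, by
    \<open>k sin y \<rho> = \<tau>\<close> and \<open>k cos y \<rho> = w\<close>.\<close>
  moreover have "- (k * sin y * \<rho>) + k * cos y * (- \<tau> * \<rho> * w) = - \<tau> - \<tau> * w\<^sup>2"
    unfolding s by (simp add: w_def power2_eq_square)
  moreover have "2 * (1 - 1/k) * \<tau> * ((1 - \<tau>\<^sup>2) * w) * w + (- \<tau> - \<tau> * w\<^sup>2) * slope k \<tau> = accel k \<tau>"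
  proof -
    \<comment> \<open>Only \<open>w^2\<close> remains, and
      \<open>1 + w^2 = (k^2 + 1) (1 - \<tau>^2)\<close> turns this into
      \<open>accel\<close>.\<close>
    have "2 * (1 - 1/k) * \<tau> * ((1 - \<tau>\<^sup>2) * w) * w + (- \<tau> - \<tau> * w\<^sup>2) * slope k \<tau>
        = 2 * (1 - 1/k) * \<tau> * (1 - \<tau>\<^sup>2) * w\<^sup>2 - slope k \<tau> * \<tau> * (1 + w\<^sup>2)"
      by (simp add: algebra_simps power2_eq_square)
    then show ?thesis unfolding w2 accel_def by (simp add: algebra_simps)
  qed
  ultimately show ?thesis by (simp add: \<tau>_def)
qed

text \<open>Sine, cosine, and \<open>tanh\<close> and \<open>sech\<close> of the wave have
  derivatives polynomial in each other. The function \<open>u\<close> joins as a generator because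
  it also contains the wave itself.\<close>

lemma smooth_profile_wave: "smooth_real_on S (\<lambda>x. profile k (wave k (\<omega> * (x - a))))"
proof -
  let ?y = "\<lambda>x. \<omega> * (x - a)"
  define s where "s = (\<lambda>x. sin (?y x))"
  define c where "c = (\<lambda>x. cos (?y x))"
  define \<rho> where "\<rho> = (\<lambda>x. inverse (cosh (wave k (?y x))))"
  define \<tau> where "\<tau> = (\<lambda>x. tanh (wave k (?y x)))"
  define u where "u = (\<lambda>x. profile k (wave k (?y x)))"
  note defs = s_def c_def \<rho>_def \<tau>_def u_def
  define B where "B = {s, c, \<rho>, \<tau>, u}"
  have gen: "s \<in> fun_algebra B" "c \<in> fun_algebra B" "\<rho> \<in> fun_algebra B"
      "\<tau> \<in> fun_algebra B" "u \<in> fun_algebra B"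
    by (auto simp: B_def intro: fun_algebra.gen)
  have y: "(?y has_real_derivative \<omega>) (at x)" for x
    by (auto intro!: derivative_eq_intros)
  have deriv:
    "(s has_real_derivative c x * \<omega>) (at x)"
    "(c has_real_derivative - s x * \<omega>) (at x)"
    "(\<rho> has_real_derivative - \<tau> x * \<rho> x * (k * c x * \<rho> x) * \<omega>) (at x)"
    "(\<tau> has_real_derivative (1 - (\<tau> x)\<^sup>2) * (k * c x * \<rho> x) * \<omega>) (at x)"
    "(u has_real_derivative slope k (\<tau> x) * (k * c x * \<rho> x) * \<omega>) (at x)" for x
    unfolding defs
    by (rule DERIV_chain2[OF DERIV_sin y] DERIV_chain2[OF DERIV_cos y]
        DERIV_chain2[OF sech_wave_deriv y] DERIV_chain2[OF tanh_wave_deriv y]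
        DERIV_chain2[OF profile_wave_deriv y])+
  have alg:
    "(\<lambda>x. c x * \<omega>) \<in> fun_algebra B"
    "(\<lambda>x. - s x * \<omega>) \<in> fun_algebra B"
    "(\<lambda>x. - \<tau> x * \<rho> x * (k * c x * \<rho> x) * \<omega>) \<in> fun_algebra B"
    "(\<lambda>x. (1 - (\<tau> x)\<^sup>2) * (k * c x * \<rho> x) * \<omega>) \<in> fun_algebra B"
    "(\<lambda>x. slope k (\<tau> x) * (k * c x * \<rho> x) * \<omega>) \<in> fun_algebra B"
    unfolding slope_def by (intro fun_algebra_intros gen)+
  have "smooth_real_on S u"
  proof (rule smooth_real_on_fun_algebra[OF gen(5)])
    fix g assume "g \<in> B"
    then consider "g = s" | "g = c" | "g = \<rho>" | "g = \<tau>" | "g = u" by (auto simp: B_def)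
    then show "\<exists>g'\<in>fun_algebra B. \<forall>x. (g has_real_derivative g' x) (at x)"
      by cases (erule ssubst, rule bexI, rule allI, rule deriv, rule alg)+
  qed
  then show ?thesis by (simp add: u_def)
qed

lemma profile_wave_deriv_deriv:
  "deriv (deriv (\<lambda>x. profile k (wave k (\<omega> * (x - a))))) x = \<omega>\<^sup>2 * accel k (tanh (wave k (\<omega> * (x - a))))"
proof -
  let ?y = "\<lambda>x. \<omega> * (x - a)"
  have y: "(?y has_real_derivative \<omega>) (at x)" for x
    by (auto intro!: derivative_eq_intros)
  have "deriv (\<lambda>x. profile k (wave k (?y x)))
      = (\<lambda>x. slope k (tanh (wave k (?y x))) * (k * cos (?y x) * inverse (cosh (wave k (?y x)))) * \<omega>)"
    by (intro ext DERIV_imp_deriv DERIV_chain2[OF profile_wave_deriv y])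
  moreover have "deriv \<dots> x = accel k (tanh (wave k (?y x))) * \<omega> * \<omega>"
    by (intro DERIV_imp_deriv DERIV_cmult_right DERIV_chain2[OF profile_wave_deriv2 y])
  ultimately show ?thesis by (simp add: power2_eq_square)
qed

end

section \<open>Choice of parameters and assembly\<close>

theorem theorem2p3:
  fixes a b lam :: real
  assumes "a < b" and "lam > 0"
  shows "\<exists>f :: real \<Rightarrow> real.
           smooth_real_on UNIV f \<and>
           (\<forall>s::real. (LBINT t=0..s. f t) \<le> 0) \<and>
           (\<exists>u :: real \<Rightarrow> real.
              smooth_real_on {a..b} u \<and>
              dirichlet_solution a b lam f u \<and>
              (\<exists>x\<in>{a..b}. u x \<noteq> 0))"
proof -
  \<comment> \<open>One half-period of the sine fits \<open>[a,b]\<close>, so the wave vanishes at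
    both ends.\<close>
  define \<omega> where "\<omega> = pi / (b - a)"
  \<comment> \<open>The threshold of \<open>potential_le_profile\<close> at
    \<open>\<mu> = lam / \<omega>^2\<close>; it is at least 2.\<close>
  define k where "k = 2 * exp (2 * (1 + sqrt (2 / (lam / \<omega>\<^sup>2))))"
  \<comment> \<open>Read off from the equation as \<open>-u'' - lam u\<close>;
    \<open>profile_inv k\<close> recovers the wave from \<open>u\<close> and extends the formula
    beyond the range of \<open>u\<close>.\<close>
  define f where "f = (\<lambda>v. - \<omega>\<^sup>2 * accel k (tanh (profile_inv k v)) - lam * v)"
  define u where "u = (\<lambda>x. profile k (wave k (\<omega> * (x - a))))"
  have \<omega>: "\<omega> > 0" using assms by (simp add: \<omega>_def)
  have k: "k \<ge> 2" using assms by (simp add: k_def)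
  have "\<omega> * (b - a) = pi" using assms by (simp add: \<omega>_def)
  then have bc: "u a = 0" "u b = 0" using k by (auto simp: u_def wave_def profile_zero)
  have "dirichlet_solution a b lam f u"
    unfolding dirichlet_solution_def
    by (auto simp: bc) (simp add: f_def u_def profile_wave_deriv_deriv[OF k] profile_inv[OF k])
  moreover have "u ((a + b) / 2) \<noteq> 0"
  proof -
    \<comment> \<open>At the midpoint the sine is 1.\<close>
    have "\<omega> * ((a + b) / 2 - a) = pi / 2" using assms by (simp add: \<omega>_def field_simps)
    then have "u ((a + b) / 2) = profile k (arsinh k)" using k by (simp add: u_def wave_def)
    moreover have "profile k 0 < profile k (arsinh k)"
      using profile_strict_mono[OF k] k by (simp add: strict_mono_less)
    ultimately show ?thesis using k by (simp add: profile_zero)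
  qed
  moreover have "(a + b) / 2 \<in> {a..b}" using assms by auto
  moreover have "smooth_real_on {a..b} u" unfolding u_def by (rule smooth_profile_wave[OF k])
  moreover have "smooth_real_on UNIV f" unfolding f_def by (rule smooth_nonlinearity[OF k])
  moreover have "(LBINT t=0..s. f t) \<le> 0" for s :: real
    unfolding f_def using integral_nonlinearity_nonpos[OF k, of "\<omega>\<^sup>2" lam s] \<omega> assms by (simp add: k_def)
  ultimately show ?thesis by blast
qed

end
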